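(* Let $(X,Y)=(RU_1,RU_2)$, where $R>0$ is a random variable with distribution function $F$, independent of the bivariate random vector $(U_1,U_2)$. Suppose that $F$ has an infinite upper endpoint and that $F\in GMDA(w)$ for some positive scaling function $w$. Suppose that $U_1\in(0,1]$ almost surely and that the distribution function of $U_1$ has upper endpoint $1$. Let $a\in(0,1]$, put $U_a:=\min(U_1,U_2/a)$, and suppose that $$\lim_{x\to\infty}\frac{P\{U_1>1-(s-\delta)/x,\ U_2>a(1-(s-\eta)/x)\}}{P\{U_a>1-1/x\}}=\xi_a(s,\delta,\eta),\qquad \forall\,\delta,\eta\in[0,\infty),\ \forall s\in(0,\infty),$$ where $\xi_a$ is a measurable function that is strictly positive for $s>\max(\delta,\eta)$. Further, let $\gamma\in[0,\infty)$ and let $L_a$ be a positive measurable function, slowly varying at $0$ (i.e. $\lim_{s\downarrow0}L_a(s)/L_a(ts)=1$ for all $t>0$), such that $P\{U_a>1-s\}=s^{\gamma}L_a(s)$ for $s>0$. Then for any $\delta,\eta\in[0,\infty)$, as $x\to\infty$, $$P\Bigl\{X>x\Bigl[1+\frac{\delta}{v(x)}\Bigr],\ Y>ax\Bigl[1+\frac{\eta}{v(x)}\Bigr]\Bigr\}\ \sim\ J_{\delta,\eta}\,L_a(1/v(x))\,\frac{\overline F(x)}{(v(x))^{\gamma}},$$ where $$J_{\delta,\eta}:=\int_\delta^\infty \xi_a(s,\delta,\eta)\,e^{-s}\,ds\in(0,\infty).$$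
   Context: $\overline F:=1-F$. $F\in GMDA(w)$ (Gumbel max-domain of attraction with positive scaling function $w$), for $F$ with infinite upper endpoint, means $\lim_{x\to\infty}\overline F(x+t/w(x))/\overline F(x)=e^{-t}$ for all $t\in\mathbb R$. $v(x):=x\,w(x)$. $f(x)\sim g(x)$ means $\lim_{x\to\infty}f(x)/g(x)=1$. *)

theory Defs
  imports "HOL-Probability.Probability"
begin

definition upper_endpoint :: "(real \<Rightarrow> real) \<Rightarrow> ereal" where
  "upper_endpoint F = Sup {ereal x | x. F x < 1}"

text \<open>Gumbel max-domain of attraction with scaling function \<open>w\<close>. This form of the limit relation is
  the right one only for a distribution function \<open>F\<close> with infinite upper endpoint, so that
  \<open>1 - F\<close> never vanishes.\<close>

definition GMDA :: "(real \<Rightarrow> real) \<Rightarrow> (real \<Rightarrow> real) \<Rightarrow> bool" where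
  "GMDA w F \<longleftrightarrow> (\<forall>t. ((\<lambda>x. (1 - F (x + t / w x)) / (1 - F x)) \<longlongrightarrow> exp (- t)) at_top)"

definition slowly_varying_at_0 :: "(real \<Rightarrow> real) \<Rightarrow> bool" where
  "slowly_varying_at_0 L \<longleftrightarrow> (\<forall>t>0. ((\<lambda>s. L s / L (t * s)) \<longlongrightarrow> 1) (at_right 0))"

end

theory Submission
  imports Defs "HOL-Real_Asymp.Real_Asymp"
begin

text \<open>Put \<open>S = 1 - F\<close>, \<open>b = 1 / w\<close> and \<open>p s = P(U\<^sub>a > 1 - s)\<close>. With the level
  \<open>Z = max (x (1 + \<delta> / v) / U\<^sub>1) (a x (1 + \<eta> / v) / U\<^sub>2)\<close> that \<open>R\<close> has to exceed and
  \<open>T = (Z - x) / b x\<close>, independence turns the joint tail into \<open>E[S (x + T b x)]\<close>, while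
  \<open>P(T < s) / p (1 / v)\<close> converges to \<open>\<xi> s \<delta> \<eta>\<close>. If \<open>S (x + t b x) / S x\<close> is replaced by its limit
  \<open>exp (- t)\<close>, then \<open>E[exp (- T)] = \<integral> exp (- s) P(T < s) ds\<close> and dominated convergence give \<open>J\<close>:
  monotonicity and regular variation make \<open>p\<close> a doubling function, so \<open>P(T < s) / p (1 / v)\<close> is bounded
  by a power of \<open>1 + s\<close>. The replacement is harmless because the convergence to \<open>exp (- t)\<close> is uniform in
  \<open>t \<ge> 0\<close> even after multiplication by any power of \<open>1 + t\<close>.\<close>

section \<open>Tails in the Gumbel domain of attraction\<close>

text \<open>The setting of \<open>S = 1 - F\<close> and \<open>b = 1 / w\<close> in abstract form:
  \<open>S_pos\<close> is what an infinite upper endpoint provides, and \<open>b_pos\<close> is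
  restricted to positive arguments because \<open>w\<close> is known to be positive only
  there.\<close>

locale gumbel_tail =
  fixes S b :: "real \<Rightarrow> real"
  assumes antimono: "x \<le> y \<Longrightarrow> S y \<le> S x"
    and S_pos: "S x > 0"
    and b_pos: "x > 0 \<Longrightarrow> b x > 0"
    and tail_limit: "((\<lambda>x. S (x + t * b x) / S x) \<longlongrightarrow> exp (- t)) at_top"
begin

lemma filterlim_step: "filterlim (\<lambda>x. x + b x) at_top at_top"
proof (rule filterlim_at_top_mono[OF filterlim_ident])
  show "\<forall>\<^sub>F x in at_top. x \<le> x + b x"
    using eventually_gt_at_top[of 0] by eventually_elim (simp add: b_pos less_imp_le)
qed

text \<open>Two successive steps, the second of length \<open>b (x + b x)\<close>, multiply
  \<open>S\<close> by about \<open>exp (-2)\<close>; a single jump of \<open>(1 + q) * b x\<close>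
  multiplies it by about \<open>exp (-(1 + q))\<close>, which is smaller. As \<open>S\<close> is
  nonincreasing, the two steps must end before the jump does.\<close>

lemma scale_step_le:
  assumes "q > 1"
  shows "\<forall>\<^sub>F x in at_top. b (x + b x) \<le> q * b x"
proof -
  have 1: "((\<lambda>x. S (x + b x) / S x) \<longlongrightarrow> exp (-1)) at_top"
    using tail_limit[of 1] by simp
  have 2: "((\<lambda>x. S ((x + b x) + b (x + b x)) / S (x + b x)) \<longlongrightarrow> exp (-1)) at_top"
    using filterlim_compose[OF 1 filterlim_step] .
  have "((\<lambda>x. S ((x + b x) + b (x + b x)) / S x) \<longlongrightarrow> exp (-1) * exp (-1)) at_top"
    using tendsto_mult[OF 2 1] S_pos by (simp add: less_imp_neq[symmetric])
  moreover have "exp (-(1+q)) < exp (-1) * exp (-1 :: real)"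
    using assms by (simp flip: exp_add)
  then obtain c where c: "exp (-(1+q)) < c" "c < exp (-1) * exp (-1 :: real)"
    using dense by blast
  ultimately have "\<forall>\<^sub>F x in at_top. c < S ((x + b x) + b (x + b x)) / S x"
    by (auto dest: order_tendstoD)
  moreover have "\<forall>\<^sub>F x in at_top. S (x + (1+q) * b x) / S x < c"
    using order_tendstoD(2)[OF tail_limit c(1)] .
  ultimately show ?thesis
  proof eventually_elim
    case (elim x)
    then have "S (x + (1+q) * b x) < S ((x + b x) + b (x + b x))"
      using S_pos[of x] by (meson divide_le_cancel le_less_trans less_asym less_trans not_le)
    then have "\<not> (x + (1+q) * b x \<le> (x + b x) + b (x + b x))"
      using antimono by (meson not_le)
    then show ?case by (simp add: algebra_simps)
  qed
qed

text \<open>Iterating \<open>x \<mapsto> x + b x\<close> more than halves \<open>S\<close> at each step, whereas \<open>b\<close> grows at most by a factor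
  \<open>q\<close> arbitrarily close to 1; so \<open>n\<close> steps cover a distance of at most \<open>(q ^ n - 1) / (q - 1) * b x\<close>.\<close>

lemma tail_power_bound:
  fixes K :: nat
  shows "\<exists>C>0. \<forall>\<^sub>F x in at_top. \<forall>t\<ge>0. S (x + t * b x) / S x \<le> C / (1 + t) ^ K"
proof -
  \<comment> \<open>With \<open>q ^ Suc K = 2\<close> the K-th power of the growth
    \<open>q ^ n\<close> is at most \<open>2 ^ n\<close>, so the halving of \<open>S\<close> wins.
    The index \<open>Suc K\<close> keeps the root meaningful for \<open>K = 0\<close>.\<close>
  define q where "q = root (Suc K) 2"
  have q: "q > 1" "q ^ Suc K = 2" by (simp_all add: q_def del: power_Suc)
  have qK: "q ^ K \<le> 2" using q power_increasing[of K "Suc K" q] by simp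
  have half: "exp (-1) < (1/2 :: real)"
  proof -
    have "(1 + 1/2)^2 \<le> exp (1/2 :: real) ^ 2" by (intro power_mono exp_ge_add_one_self) auto
    also have "\<dots> = exp 1" by (simp flip: exp_of_nat_mult)
    finally have "2 < exp (1::real)" by (simp add: power2_eq_square)
    then show ?thesis by (simp add: exp_minus divide_simps)
  qed
  have "\<forall>\<^sub>F x in at_top. x > 0 \<and> b (x + b x) \<le> q * b x \<and> S (x + b x) / S x < 1/2"
    using eventually_gt_at_top[of 0] scale_step_le[OF q(1)]
      order_tendstoD(2)[OF tail_limit[of 1] half]
    by eventually_elim auto
  then obtain x0 where x0: "\<And>x. x \<ge> x0 \<Longrightarrow> x > 0 \<and> b (x + b x) \<le> q * b x \<and> S (x + b x) / S x < 1/2"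
    by (auto simp: eventually_at_top_linorder)
  \<comment> \<open>The condition says \<open>t \<ge> 1 + q + ... + q ^ (n - 1)\<close>, the most
    that \<open>n\<close> steps can cover in units of \<open>b x\<close>. The induction peels off
    the first step; \<open>t'\<close> is the remaining distance \<open>(t - 1) * b x\<close> in
    units of \<open>q * b x\<close>, which is at least \<open>b y\<close>.\<close>
  have geo: "S (x + t * b x) \<le> (1/2)^n * S x" if "x \<ge> x0" "(q^n - 1) \<le> t * (q - 1)" for n x t
    using that
  proof (induction n arbitrary: x t)
    case 0
    then have "t \<ge> 0" using q by (simp add: zero_le_mult_iff)
    then show ?case using x0[OF 0(1)] b_pos[of x] by (auto intro!: antimono)
  next
    case (Suc n)
    define y where "y = x + b x"
    define t' where "t' = (t - 1) / q"
    have x: "x > 0" "b y \<le> q * b x" "S y < 1/2 * S x" "b x > 0"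
      using x0[OF Suc.prems(1)] b_pos[of x] S_pos[of x] by (auto simp: y_def field_simps)
    have y: "y \<ge> x0" "b y > 0" using x Suc.prems b_pos[of y] by (auto simp: y_def)
    have t': "q^n - 1 \<le> t' * (q - 1)" "q * t' = t - 1"
      using Suc.prems(2) q by (auto simp: t'_def field_simps)
    have "t' \<ge> 0" using t'(1) q one_le_power[of q n]
      by (smt (verit) mult_less_0_iff)
    then have "t' * b y \<le> t' * (q * b x)" using x by (intro mult_left_mono)
    also have "\<dots> = (t - 1) * b x" using t'(2) by (metis mult.assoc mult.commute)
    finally have "y + t' * b y \<le> x + t * b x" by (simp add: y_def algebra_simps)
    then have "S (x + t * b x) \<le> S (y + t' * b y)" by (rule antimono)
    also have "\<dots> \<le> (1/2)^n * S y" by (rule Suc.IH[OF y(1) t'(1)])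
    also have "\<dots> \<le> (1/2)^n * (1/2 * S x)" using x by (intro mult_left_mono) auto
    finally show ?case by simp
  qed
  \<comment> \<open>Comes from \<open>1 + t \<le> (1 / (q - 1) + 1) * q ^ Suc m\<close>, shown below
    and raised to the power \<open>K\<close>; the summand 1 makes positivity immediate.\<close>
  define C where "C = (q * (1 / (q - 1) + 1)) ^ K + 1"
  have "S (x + t * b x) / S x \<le> C / (1 + t) ^ K" if x: "x \<ge> x0" and t: "t \<ge> 0" for x t
  proof -
    \<comment> \<open>The predecessor \<open>m\<close> of \<open>n\<close> is the largest number of
      steps that \<open>geo\<close> allows within \<open>t\<close>; minimality makes
      \<open>q ^ m\<close> comparable to \<open>1 + t\<close>.\<close>
    define n where "n = (LEAST n. t * (q - 1) + 1 < q ^ n)"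
    have n: "t * (q - 1) + 1 < q ^ n" unfolding n_def
      using real_arch_pow[OF q(1)] by (rule LeastI_ex)
    have "t * (q - 1) \<ge> 0" using t q by simp
    moreover have "t * (q - 1) < 0" if "n = 0" using n that by simp
    ultimately have "n \<noteq> 0" by linarith
    then obtain m where m: "n = Suc m" by (cases n) auto
    have "\<not> (t * (q - 1) + 1 < q ^ m)"
      using not_less_Least[of m "\<lambda>n. t * (q - 1) + 1 < q ^ n"] m by (simp add: n_def)
    then have "S (x + t * b x) \<le> (1/2)^m * S x" using geo[OF x, of m t] by auto
    then have 1: "S (x + t * b x) / S x \<le> (1/2)^m" using S_pos[of x] by (simp add: divide_simps)
    have "(q ^ m) ^ K \<le> 2 ^ m"
      using power_mono[OF qK, of m] q by (simp add: mult.commute flip: power_mult)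
    then have 2: "(1/2)^m \<le> 1 / (q ^ m) ^ K" using q by (simp add: divide_simps power_one_over)
    have "(1 / (q - 1) + 1) * (t * (q - 1) + 1) = 1 + t + (1 / (q - 1) + t * (q - 1))"
      using q by (simp add: field_simps)
    then have "1 + t \<le> (1 / (q - 1) + 1) * (t * (q - 1) + 1)"
      using t q by simp
    also have "\<dots> \<le> (1 / (q - 1) + 1) * q ^ Suc m"
      using n m q by (intro mult_left_mono) auto
    finally have "(1 + t) \<le> (q * (1 / (q - 1) + 1)) * q ^ m" by (simp add: algebra_simps)
    then have "(1 + t) ^ K \<le> ((q * (1 / (q - 1) + 1)) * q ^ m) ^ K"
      using t by (intro power_mono) auto
    also have "\<dots> \<le> C * (q ^ m) ^ K"
      unfolding power_mult_distrib C_def using q by (intro mult_right_mono) auto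
    finally have "1 / (q ^ m) ^ K \<le> C / (1 + t) ^ K" using q t by (simp add: divide_simps mult.commute)
    then show ?thesis using 1 2 by linarith
  qed
  moreover have "C > 0" using q unfolding C_def by (intro add_nonneg_pos zero_le_power) auto
  ultimately show ?thesis
    unfolding eventually_at_top_linorder by blast
qed

text \<open>On a compact interval \<open>{0..A}\<close> pointwise convergence on a finite grid
  suffices, because \<open>S\<close> is monotone and the limit is continuous. Beyond
  \<open>A\<close> the ratio and the limit are each below the allowed error.\<close>

lemma tail_weighted_uniform_limit:
  fixes K :: nat
  assumes "\<epsilon> > 0"
  shows "\<forall>\<^sub>F x in at_top. \<forall>t\<ge>0. \<bar>S (x + t * b x) / S x - exp (- t)\<bar> \<le> \<epsilon> / (1 + t) ^ K"
proof -
  \<comment> \<open>One degree more than required: the spare factor \<open>1 / (1 + t)\<close> makes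
    the bound small for large \<open>t\<close>.\<close>
  obtain C where "C > 0" and bd: "\<forall>\<^sub>F x in at_top. \<forall>t\<ge>0. S (x + t * b x) / S x \<le> C / (1 + t) ^ Suc K"
    using tail_power_bound by blast
  have "\<forall>\<^sub>F t in at_top. C / (1 + t) < \<epsilon>/2 \<and> exp (-t) * (1 + t)^K < \<epsilon>"
  proof (intro eventually_conj order_tendstoD)
    show "((\<lambda>t. C / (1 + t)) \<longlongrightarrow> 0) at_top" by real_asymp
    have "filterlim (\<lambda>t::real. 1 + t) at_top at_top" by real_asymp
    then have "((\<lambda>t::real. exp 1 * ((1 + t)^K / exp (1 + t))) \<longlongrightarrow> exp 1 * 0) at_top"
      by (intro tendsto_mult tendsto_const filterlim_compose[OF tendsto_power_div_exp_0])
    then show "((\<lambda>t::real. exp (-t) * (1 + t)^K) \<longlongrightarrow> 0) at_top"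
      by (simp add: exp_add exp_minus field_simps)
  qed (use assms in auto)
  then obtain A0 where A0: "\<And>t. t \<ge> A0 \<Longrightarrow> C / (1 + t) < \<epsilon>/2 \<and> exp (-t) * (1 + t)^K < \<epsilon>"
    by (auto simp: eventually_at_top_linorder)
  define A where "A = max A0 0"
  \<comment> \<open>The mesh is half of the smallest error allowed on \<open>{0..A}\<close>.
    Convergence at a node and the variation of \<open>exp (- t)\<close> between neighbours each cost
    at most \<open>h\<close>. Nodes run to \<open>Suc N\<close> so that every
    \<open>t \<le> A\<close> has a right neighbour.\<close>
  define h where "h = \<epsilon> / (1 + A) ^ K / 2"
  have h: "h > 0" and A: "A \<ge> 0" using assms by (auto simp: h_def A_def)
  define N where "N = nat \<lceil>A / h\<rceil>"
  have "\<forall>\<^sub>F x in at_top. \<forall>i\<in>{..Suc N}. \<bar>S (x + real i * h * b x) / S x - exp (- (real i * h))\<bar> < h"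
    using tail_limit h by (intro eventually_ball_finite) (auto simp: tendsto_iff dist_real_def)
  then show ?thesis using bd eventually_gt_at_top[of 0]
  proof eventually_elim
    case (elim x)
    have bx: "b x > 0" using elim b_pos by auto
    show ?case
    proof (intro allI impI)
      fix t :: real assume t: "t \<ge> 0"
      show "\<bar>S (x + t * b x) / S x - exp (- t)\<bar> \<le> \<epsilon> / (1 + t) ^ K"
      proof (cases "t \<le> A")
        case True
        define i where "i = nat \<lfloor>t / h\<rfloor>"
        have i: "real i * h \<le> t" "t \<le> real (Suc i) * h"
          using t h by (auto simp: i_def pos_divide_le_eq[symmetric] pos_le_divide_eq[symmetric]) linarith
        have "t / h \<le> A / h" using True h by (simp add: divide_right_mono)
        then have "i \<le> N" by (auto simp: i_def N_def) linarith
        then have "\<bar>S (x + real i * h * b x) / S x - exp (- (real i * h))\<bar> < h"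
           "\<bar>S (x + real (Suc i) * h * b x) / S x - exp (- (real (Suc i) * h))\<bar> < h"
          using elim(1) by (auto simp del: of_nat_Suc)
        moreover have "S (x + t * b x) / S x \<le> S (x + real i * h * b x) / S x"
           "S (x + real (Suc i) * h * b x) / S x \<le> S (x + t * b x) / S x"
          using i bx S_pos[of x]
          by (auto intro!: divide_right_mono antimono mult_right_mono simp del: of_nat_Suc)
        moreover have lip: "exp (-u) \<le> exp (-u') + h" if "0 \<le> u" "u \<le> u'" "u' \<le> u + h" for u u' :: real
        proof -
          have X: "1 - exp (-(u'-u)) \<le> u' - u" using exp_ge_add_one_self[of "-(u'-u)"] by linarith
          have "exp (-u) * (1 - exp (-(u'-u))) \<le> 1 * (u' - u)"
            by (intro mult_mono X) (use that in auto)
          then show ?thesis using that by (simp add: algebra_simps flip: exp_add)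
        qed
        moreover have "exp (- (real i * h)) \<le> exp (- t) + h"
          using i h by (intro lip) (auto simp: algebra_simps)
        moreover have "exp (- t) \<le> exp (- (real (Suc i) * h)) + h"
          using i h t by (intro lip) (auto simp: algebra_simps)
        ultimately have "\<bar>S (x + t * b x) / S x - exp (- t)\<bar> \<le> 2 * h" by linarith
        also have "\<dots> \<le> \<epsilon> / (1 + t) ^ K"
          using True t A assms by (auto simp: h_def intro!: divide_left_mono power_mono)
        finally show ?thesis .
      next
        case False
        then have "t \<ge> A0" by (simp add: A_def)
        note At = A0[OF this]
        have 1: "S (x + t * b x) / S x \<le> C / (1 + t) / (1 + t) ^ K" using elim(2) t by simp
        have "C / (1 + t) / (1 + t) ^ K \<le> \<epsilon> / (1 + t) ^ K"
          using At t assms by (intro divide_right_mono zero_le_power) linarith+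
        moreover have "exp (-t) \<le> \<epsilon> / (1 + t) ^ K" using At t by (simp add: pos_le_divide_eq)
        moreover have "S (x + t * b x) / S x > 0" using S_pos by simp
        ultimately show ?thesis using 1 exp_gt_zero[of "-t"] by (smt (verit))
      qed
    qed
  qed
qed

end

text \<open>If \<open>x < c * b x\<close> for large \<open>x\<close>, then
  \<open>x - c * b x\<close> is negative, where \<open>S\<close> is 1. The tail ratio for
  \<open>t = - c\<close> is then \<open>1 / S x\<close>, which is too large to be near its limit
  \<open>exp c\<close>.\<close>

lemma (in gumbel_tail) filterlim_ratio_scale:
  assumes "(S \<longlongrightarrow> 0) at_top" and "\<And>x. x \<le> 0 \<Longrightarrow> S x = 1"
  shows "filterlim (\<lambda>x. x / b x) at_top at_top"
  unfolding filterlim_at_top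
proof
  fix c :: real
  have "\<forall>\<^sub>F x in at_top. S (x + (- c) * b x) / S x < exp (- (- c)) + 1"
    by (rule order_tendstoD(2)[OF tail_limit]) simp
  moreover have "\<forall>\<^sub>F x in at_top. S x < 1 / (exp c + 1)"
    by (rule order_tendstoD(2)[OF assms(1)]) (simp add: add_pos_pos)
  ultimately show "\<forall>\<^sub>F x in at_top. c \<le> x / b x" using eventually_gt_at_top[of 0]
  proof eventually_elim
    case (elim x)
    show ?case
    proof (rule ccontr)
      assume "\<not> c \<le> x / b x"
      then have "x + (- c) * b x \<le> 0"
        using b_pos[OF elim(3)] by (simp add: not_le divide_less_eq)
      then have "1 / S x < exp c + 1" using elim(1) assms(2) by simp
      then have "1 < (exp c + 1) * S x" using S_pos[of x] by (simp add: divide_less_eq)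
      moreover have "(exp c + 1) * S x < 1"
        using elim(2) by (simp add: less_divide_eq add_pos_pos mult.commute)
      ultimately show False by simp
    qed
  qed
qed

lemma less_one_of_upper_endpoint_infinity:
  assumes "upper_endpoint F = \<infinity>" and "mono F"
  shows "F x < 1"
proof -
  have "ereal x < Sup {ereal x | x. F x < 1}" using assms(1) by (simp add: upper_endpoint_def)
  then obtain y where "F y < 1" "x < y" by (auto simp: less_Sup_iff)
  then show ?thesis using monoD[OF assms(2), of x y] by simp
qed

section \<open>Regular variation of monotone functions\<close>

text \<open>Double up to the first power of 2 that reaches \<open>1 + s\<close>. Using
  \<open>1 + s\<close> instead of \<open>s\<close> forces at least one doubling, so minimality
  yields \<open>2 ^ n \<le> 2 * (1 + s)\<close> for small \<open>s\<close> too.\<close>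

lemma doubling_imp_power_bound:
  fixes p :: "real \<Rightarrow> real"
  assumes mono: "\<And>x y. 0 < x \<Longrightarrow> x \<le> y \<Longrightarrow> p x \<le> p y"
    and pos: "\<And>x. x > 0 \<Longrightarrow> p x > 0"
    and doubling: "\<And>u. u > 0 \<Longrightarrow> p (2 * u) \<le> 2 ^ k * p u"
    and "s > 0" "u > 0"
  shows "p (s * u) \<le> (2 * (1 + s)) ^ k * p u"
proof -
  define n where "n = (LEAST n. 1 + s \<le> 2 ^ n)"
  have "\<exists>n. 1 + s < 2 ^ n" by (rule real_arch_pow) simp
  then have n: "1 + s \<le> 2 ^ n" unfolding n_def by (metis LeastI less_imp_le)
  then have "n \<noteq> 0" using \<open>s > 0\<close> by (cases n) auto
  then obtain m where m: "n = Suc m" by (cases n) auto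
  have "\<not> (1 + s \<le> 2 ^ m)"
    using not_less_Least[of m "\<lambda>n. 1 + s \<le> 2 ^ n"] m by (simp add: n_def)
  then have n': "2 ^ n \<le> 2 * (1 + s)" using m by simp
  have iter: "p (2 ^ j * u) \<le> (2 ^ j) ^ k * p u" for j
  proof (induction j)
    case (Suc j)
    have "p (2 ^ Suc j * u) \<le> 2 ^ k * p (2 ^ j * u)"
      using doubling[of "2 ^ j * u"] \<open>u > 0\<close> by (simp add: mult.assoc)
    also have "\<dots> \<le> 2 ^ k * ((2 ^ j) ^ k * p u)" using Suc by simp
    finally show ?case by (simp add: power_mult_distrib)
  qed simp
  have "p (s * u) \<le> p (2 ^ n * u)"
    using n assms by (intro mono mult_right_mono mult_pos_pos) auto
  also have "\<dots> \<le> (2 ^ n) ^ k * p u" by (rule iter)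
  also have "\<dots> \<le> (2 * (1 + s)) ^ k * p u"
    using n' pos[OF \<open>u > 0\<close>] by (intro mult_right_mono power_mono) auto
  finally show ?thesis .
qed

text \<open>The limit gives a doubling constant near 0 only. Away from 0, \<open>p\<close> lies
  between \<open>p u0 > 0\<close> and 1, so \<open>1 / p u0\<close> is one; \<open>2 ^ k\<close> is
  chosen above both.\<close>

lemma bounded_regularly_varying_power_bound:
  fixes p :: "real \<Rightarrow> real"
  assumes mono: "\<And>x y. 0 < x \<Longrightarrow> x \<le> y \<Longrightarrow> p x \<le> p y"
    and pos: "\<And>x. x > 0 \<Longrightarrow> p x > 0"
    and le_one: "\<And>x. p x \<le> 1"
    and lim: "((\<lambda>u. p (2 * u) / p u) \<longlongrightarrow> l) (at_right 0)"
  shows "\<exists>k. \<forall>s>0. \<forall>u>0. p (s * u) \<le> (2 * (1 + s)) ^ k * p u"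
proof -
  have "\<forall>\<^sub>F u in at_right 0. p (2 * u) / p u < l + 1"
    by (rule order_tendstoD(2)[OF lim]) simp
  then obtain u0 where u0: "u0 > 0" "\<And>u. 0 < u \<Longrightarrow> u < u0 \<Longrightarrow> p (2 * u) / p u < l + 1"
    by (auto simp: eventually_at_right_field)
  obtain k where k: "max (l + 1) (1 / p u0) < 2 ^ k"
    using real_arch_pow[of 2 "max (l + 1) (1 / p u0)"] by (meson one_less_numeral_iff semiring_norm(76))
  have "p (2 * u) \<le> 2 ^ k * p u" if "u > 0" for u
  proof (cases "u < u0")
    case True
    then show ?thesis using u0(2)[OF that True] k pos[OF that]
      by (smt (verit) divide_less_eq max.strict_boundedE mult_right_mono mult.commute)
  next
    case False
    have "1 \<le> 2 ^ k * p u0" using k pos[OF u0(1)] by (simp add: divide_less_eq less_imp_le)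
    also have "\<dots> \<le> 2 ^ k * p u" using False mono[of u0 u] u0 by simp
    finally show ?thesis using le_one[of "2 * u"] by linarith
  qed
  then have "p (s * u) \<le> (2 * (1 + s)) ^ k * p u" if "s > 0" "u > 0" for s u
    using doubling_imp_power_bound[of p k s u] mono pos that by blast
  then show ?thesis by blast
qed

text \<open>For every \<open>t < 1\<close>, \<open>1 / (z + s)\<close> lies between
  \<open>t / z\<close> and \<open>1 / z\<close> as soon as \<open>z \<ge> t * s / (1 - t)\<close>.
  Monotonicity squeezes the quotient between values near \<open>t powr \<gamma>\<close> and 1; then
  \<open>t\<close> tends to 1.\<close>

lemma regularly_varying_shift:
  fixes p :: "real \<Rightarrow> real"
  assumes mono: "\<And>x y. 0 < x \<Longrightarrow> x \<le> y \<Longrightarrow> p x \<le> p y"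
    and pos: "\<And>x. x > 0 \<Longrightarrow> p x > 0"
    and lim: "\<And>t. t > 0 \<Longrightarrow> ((\<lambda>u. p (t * u) / p u) \<longlongrightarrow> t powr \<gamma>) (at_right 0)"
    and s: "s > 0"
  shows "((\<lambda>z. p (1 / (z + s)) / p (1 / z)) \<longlongrightarrow> 1) at_top"
proof (rule order_tendstoI)
  fix c :: real assume c: "c < 1"
  have "((\<lambda>t. t powr \<gamma>) \<longlongrightarrow> 1 powr \<gamma>) (at_left (1::real))"
    by (intro tendsto_intros) auto
  then have "\<forall>\<^sub>F t in at_left (1::real). c < t powr \<gamma>"
    using c by (auto dest: order_tendstoD)
  then obtain t0 where "t0 < 1" "\<And>t. t0 < t \<Longrightarrow> t < 1 \<Longrightarrow> c < t powr \<gamma>"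
    by (auto simp: eventually_at_left_field)
  then obtain t where t: "0 < t" "t < 1" "c < t powr \<gamma>"
    using dense[of "max t0 0" 1] by auto
  have "((\<lambda>z. p (t * (1 / z)) / p (1 / z)) \<longlongrightarrow> t powr \<gamma>) at_top"
    by (rule filterlim_compose[OF lim[OF t(1)]]) real_asymp
  then have "\<forall>\<^sub>F z in at_top. c < p (t * (1 / z)) / p (1 / z)"
    using t by (auto dest: order_tendstoD)
  then show "\<forall>\<^sub>F z in at_top. c < p (1 / (z + s)) / p (1 / z)"
    using eventually_gt_at_top[of "0"] eventually_ge_at_top[of "t * s / (1 - t)"]
  proof eventually_elim
    case (elim z)
    have "t * (1 / z) \<le> 1 / (z + s)" using elim t s by (simp add: field_simps)
    then have "p (t * (1 / z)) \<le> p (1 / (z + s))" using elim t by (intro mono) auto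
    then show ?case using elim pos[of "1/z"] 
      by (meson divide_right_mono less_le_trans less_imp_le zero_less_divide_1_iff)
  qed
next
  fix c :: real assume c: "1 < c"
  show "\<forall>\<^sub>F z in at_top. p (1 / (z + s)) / p (1 / z) < c"
    using eventually_gt_at_top[of "0"]
  proof eventually_elim
    case (elim z)
    have "p (1 / (z + s)) \<le> p (1 / z)" using elim s by (intro mono) (auto simp: field_simps)
    then have "p (1 / (z + s)) / p (1 / z) \<le> 1" using pos[of "1/z"] elim by simp
    then show ?case using c by simp
  qed
qed

section \<open>Expectations of the tail ratio\<close>

text \<open>Tonelli's theorem for \<open>\<phi> t = \<integral>\<^sub>t\<^sup>\<infinity> g\<close>.\<close>

lemma (in finite_measure) integral_tail_function:
  fixes g \<phi> :: "real \<Rightarrow> real"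
  assumes [measurable]: "Measurable.pred M Q" "T \<in> borel_measurable M"
      "g \<in> borel_measurable borel" "\<phi> \<in> borel_measurable borel"
    and T_nonneg: "AE \<omega> in M. Q \<omega> \<longrightarrow> 0 \<le> T \<omega>"
    and g_nonneg: "\<And>s. s \<ge> 0 \<Longrightarrow> g s \<ge> 0" and \<phi>_nonneg: "\<And>s. s \<ge> 0 \<Longrightarrow> \<phi> s \<ge> 0"
    and \<phi>: "\<And>t. t \<ge> 0 \<Longrightarrow> (\<integral>\<^sup>+s. ennreal (g s) * indicator {t<..} s \<partial>lborel) = ennreal (\<phi> t)"
  shows "(\<integral>\<omega>. indicator {\<omega>. Q \<omega>} \<omega> * \<phi> (T \<omega>) \<partial>M) =
    (\<integral>s. indicator {0<..} s * (g s * measure M {\<omega> \<in> space M. Q \<omega> \<and> T \<omega> < s}) \<partial>lborel)"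
proof -
  interpret pair_sigma_finite M lborel ..
  have AE_nonneg: "AE \<omega> in M. 0 \<le> indicator {\<omega>. Q \<omega>} \<omega> * \<phi> (T \<omega>)"
    using T_nonneg \<phi>_nonneg by (auto simp: indicator_def)
  \<comment> \<open>Since \<open>T\<close> is nonnegative on \<open>Q\<close>, cutting
    \<open>s\<close> down to \<open>{0<..}\<close> changes nothing there; it confines
    \<open>g\<close> to the range where it is known to be nonnegative.\<close>
  have "(\<integral>\<^sup>+\<omega>. ennreal (indicator {\<omega>. Q \<omega>} \<omega> * \<phi> (T \<omega>)) \<partial>M) =
     (\<integral>\<^sup>+\<omega>. (\<integral>\<^sup>+s. indicator {\<omega>. Q \<omega>} \<omega> * (ennreal (g s) * indicator {0<..} s * indicator {T \<omega><..} s) \<partial>lborel) \<partial>M)"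
  proof (rule nn_integral_cong_AE, use T_nonneg in eventually_elim)
    case (elim \<omega>)
    show ?case
    proof (cases "Q \<omega>")
      case True
      then have "(\<integral>\<^sup>+s. ennreal (g s) * indicator {0<..} s * indicator {T \<omega><..} s \<partial>lborel)
          = (\<integral>\<^sup>+s. ennreal (g s) * indicator {T \<omega><..} s \<partial>lborel)"
        using elim by (intro nn_integral_cong) (auto simp: indicator_def)
      then show ?thesis using True elim \<phi>[of "T \<omega>"] by simp
    qed simp
  qed
  also have "\<dots> = (\<integral>\<^sup>+s. (\<integral>\<^sup>+\<omega>. indicator {\<omega>. Q \<omega>} \<omega> * (ennreal (g s) * indicator {0<..} s * indicator {T \<omega><..} s) \<partial>M) \<partial>lborel)"
    unfolding indicator_def mem_Collect_eq greaterThan_iff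
    by (rule Fubini'[symmetric]) measurable
  also have "\<dots> = (\<integral>\<^sup>+s. ennreal (g s) * indicator {0<..} s * emeasure M {\<omega> \<in> space M. Q \<omega> \<and> T \<omega> < s} \<partial>lborel)"
  proof (rule nn_integral_cong)
    fix s
    have "(\<integral>\<^sup>+\<omega>. indicator {\<omega>. Q \<omega>} \<omega> * (ennreal (g s) * indicator {0<..} s * indicator {T \<omega><..} s) \<partial>M)
       = (\<integral>\<^sup>+\<omega>. (ennreal (g s) * indicator {0<..} s) * indicator {\<omega> \<in> space M. Q \<omega> \<and> T \<omega> < s} \<omega> \<partial>M)"
      by (intro nn_integral_cong) (auto simp: indicator_def)
    also have "\<dots> = ennreal (g s) * indicator {0<..} s * emeasure M {\<omega> \<in> space M. Q \<omega> \<and> T \<omega> < s}"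
      by (rule nn_integral_cmult_indicator) measurable
    finally show "(\<integral>\<^sup>+\<omega>. indicator {\<omega>. Q \<omega>} \<omega> * (ennreal (g s) * indicator {0<..} s * indicator {T \<omega><..} s) \<partial>M) = \<dots>" .
  qed
  also have "\<dots> = (\<integral>\<^sup>+s. ennreal (indicator {0<..} s * (g s * measure M {\<omega> \<in> space M. Q \<omega> \<and> T \<omega> < s})) \<partial>lborel)"
    by (intro nn_integral_cong) (auto simp: indicator_def emeasure_eq_measure ennreal_mult g_nonneg)
  finally have eq: "(\<integral>\<^sup>+\<omega>. ennreal (indicator {\<omega>. Q \<omega>} \<omega> * \<phi> (T \<omega>)) \<partial>M) = \<dots>" .
  \<comment> \<open>Both Bochner integrals are \<open>enn2real\<close> of the same nonnegative
    integral, which settles the equation without a separate integrability proof.\<close>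
  have "(\<integral>\<omega>. indicator {\<omega>. Q \<omega>} \<omega> * \<phi> (T \<omega>) \<partial>M) =
      enn2real (\<integral>\<^sup>+\<omega>. ennreal (indicator {\<omega>. Q \<omega>} \<omega> * \<phi> (T \<omega>)) \<partial>M)"
    by (rule integral_eq_nn_integral) (use AE_nonneg in measurable)
  also have "\<dots> = (\<integral>s. indicator {0<..} s * (g s * measure M {\<omega> \<in> space M. Q \<omega> \<and> T \<omega> < s}) \<partial>lborel)"
    unfolding eq
    by (rule integral_eq_nn_integral[symmetric]) (auto simp: indicator_def g_nonneg)
  finally show ?thesis .
qed

lemma nn_integral_exp_tail:
  "(\<integral>\<^sup>+s. ennreal (exp (- s)) * indicator {t<..} s \<partial>lborel) = ennreal (exp (- t))" for t :: real
proof -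
  have "(\<integral>\<^sup>+s. ennreal (exp (- s)) * indicator {t<..} s \<partial>lborel) =
        (\<integral>\<^sup>+s. ennreal (exp (- s)) * indicator {t..} s \<partial>lborel)"
    using AE_lborel_singleton[of t] by (intro nn_integral_cong_AE) (auto simp: indicator_def)
  also have "\<dots> = ennreal (0 - (- exp (- t)))"
  proof (rule nn_integral_FTC_atLeast)
    show "((\<lambda>x. - exp (- x)) \<longlongrightarrow> (0::real)) at_top" by real_asymp
  qed (auto intro!: derivative_eq_intros)
  finally show ?thesis by simp
qed

text \<open>Supplies the density for the weight \<open>1 / (1 + t) ^ Suc k\<close>; the case
  \<open>k = 0\<close>, \<open>t = 0\<close> says that \<open>1 / (1 + s)\<^sup>2\<close> has mass 1
  on the positive half-line.\<close>

lemma nn_integral_power_tail: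
  assumes "t \<ge> 0"
  shows "(\<integral>\<^sup>+s. ennreal (real (Suc k) / (1 + s) ^ (k + 2)) * indicator {t<..} s \<partial>lborel)
    = ennreal (1 / (1 + t) ^ Suc k)"
proof -
  have "(\<integral>\<^sup>+s. ennreal (real (Suc k) / (1 + s) ^ (k + 2)) * indicator {t<..} s \<partial>lborel) =
        (\<integral>\<^sup>+s. ennreal (real (Suc k) / (1 + s) ^ (k + 2)) * indicator {t..} s \<partial>lborel)"
    using AE_lborel_singleton[of t] by (intro nn_integral_cong_AE) (auto simp: indicator_def)
  also have "\<dots> = ennreal (0 - (- (1 / (1 + t) ^ Suc k)))"
  proof (rule nn_integral_FTC_atLeast)
    have "filterlim (\<lambda>t::real. 1 + t) at_top at_top" by real_asymp
    then have "((\<lambda>x. - inverse ((1 + x :: real) ^ Suc k)) \<longlongrightarrow> - 0) at_top"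
      by (intro tendsto_minus filterlim_compose[OF tendsto_inverse_0_at_top filterlim_pow_at_top]
          tendsto_inverse_0_at_top filterlim_pow_at_top) auto
    then show "((\<lambda>x. - (1 / (1 + x :: real) ^ Suc k)) \<longlongrightarrow> 0) at_top"
      by (simp add: inverse_eq_divide)
  next
    fix x assume "t \<le> x"
    then have x: "1 + x \<noteq> 0" using assms by simp
    have "((\<lambda>x. - (1 / (1 + x) ^ Suc k)) has_real_derivative
        real (Suc k) * (1 + x) ^ k / ((1 + x) ^ Suc k * (1 + x) ^ Suc k)) (at x)"
      using x by (auto intro!: derivative_eq_intros simp del: power_Suc of_nat_Suc)
    also have "real (Suc k) * (1 + x) ^ k / ((1 + x) ^ Suc k * (1 + x) ^ Suc k)
        = real (Suc k) / (1 + x) ^ (k + 2)"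
      using x by (simp add: divide_simps)
    finally show "((\<lambda>x. - (1 / (1 + x) ^ Suc k)) has_real_derivative
        real (Suc k) / (1 + x) ^ (k + 2)) (at x)" .
  qed (use assms in auto)
  finally show ?thesis by simp
qed

context gumbel_tail
begin

text \<open>With \<open>exp (- T)\<close> in place of the tail ratio,
  \<open>integral_tail_function\<close> and dominated convergence give the limit. The replacement
  error is at most a small multiple of the expectation of \<open>1 / (1 + T) ^ Suc k\<close> on
  \<open>Q\<close>, which is of order \<open>r x\<close> and so stays small after division by
  \<open>r x\<close>.\<close>

lemma expectation_limit:
  fixes M :: "'a measure" and T :: "real \<Rightarrow> 'a \<Rightarrow> real" and r \<xi> :: "real \<Rightarrow> real" and k :: nat
  assumes "prob_space M"
    and [measurable]: "Measurable.pred M Q" "\<And>x. T x \<in> borel_measurable M"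
    and T_nonneg: "\<forall>\<^sub>F x in at_top. AE \<omega> in M. Q \<omega> \<longrightarrow> 0 \<le> T x \<omega>"
    and r_pos: "\<forall>\<^sub>F x in at_top. r x > 0"
    and bound: "\<forall>\<^sub>F x in at_top. \<forall>s>0. \<P>(\<omega> in M. Q \<omega> \<and> T x \<omega> < s) \<le> (2 * (1 + s)) ^ k * r x"
    and lim: "\<And>s. s > 0 \<Longrightarrow> ((\<lambda>x. \<P>(\<omega> in M. Q \<omega> \<and> T x \<omega> < s) / r x) \<longlongrightarrow> \<xi> s) at_top"
    and \<xi>_meas: "(\<lambda>s. indicator {0<..} s * \<xi> s) \<in> borel_measurable borel"
  shows "set_integrable lborel {0<..} (\<lambda>s. \<xi> s * exp (- s))"
    and "((\<lambda>x. (\<integral>\<omega>. indicator {\<omega>. Q \<omega>} \<omega> * (S (x + T x \<omega> * b x) / S x) \<partial>M) / r x)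
      \<longlongrightarrow> (LBINT s:{0<..}. \<xi> s * exp (- s))) at_top"
proof -
  interpret prob_space M by fact
  have [measurable]: "S \<in> borel_measurable borel"
  proof -
    have "mono (\<lambda>x. - S x)" using antimono by (auto simp: mono_def)
    then have "(\<lambda>x. - (- S x)) \<in> borel_measurable borel"
      by (intro borel_measurable_uminus borel_measurable_mono)
    then show ?thesis by simp
  qed
  define h where "h x s = \<P>(\<omega> in M. Q \<omega> \<and> T x \<omega> < s)" for x s
  have h_meas [measurable]: "h x \<in> borel_measurable borel" for x
    by (rule borel_measurable_mono) (auto simp: h_def mono_def intro!: finite_measure_mono)
  define W where "W s = indicator {0<..} s * ((2 * (1 + s)) ^ k * exp (- s))" for s :: real
  have W_int: "integrable lborel W"
  proof -
    have pw: "integrable lborel (\<lambda>s. indicator {0..} s * (s ^ j * exp (- s)) :: real)" for j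
    proof (rule integrableI_nonneg)
      have "(\<integral>\<^sup>+s. ennreal (indicator {0..} s * (s ^ j * exp (- s))) \<partial>lborel) =
          (\<integral>\<^sup>+s. ennreal (s ^ j * exp (- s)) * indicator {0..} s \<partial>lborel)"
        by (intro nn_integral_cong) (auto simp: indicator_def)
      also have "\<dots> < \<infinity>" by (simp add: nn_intergal_power_times_exp_Ici)
      finally show "(\<integral>\<^sup>+s. ennreal (indicator {0..} s * (s ^ j * exp (- s))) \<partial>lborel) < \<infinity>" .
    qed (auto simp: indicator_def)
    \<comment> \<open>The estimate \<open>max 1 s ^ k \<le> 1 + s ^ k\<close> reduces the dominating
      function to two Gamma integrals.\<close>
    have dom: "integrable lborel (\<lambda>s::real. 4 ^ k * (indicator {0..} s * (s ^ 0 * exp (- s))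
        + indicator {0..} s * (s ^ k * exp (- s))))"
      by (intro integrable_mult_right Bochner_Integration.integrable_add pw)
    show ?thesis
    proof (rule Bochner_Integration.integrable_bound[OF dom])
      show "AE s in lborel. norm (W s) \<le> norm (4 ^ k * (indicator {0..} s * (s ^ 0 * exp (- s))
        + indicator {0..} s * (s ^ k * exp (- s))))"
      proof (rule AE_I2)
        fix s :: real
        have "(2 * (1 + s)) ^ k \<le> 4 ^ k * (1 + s ^ k)" if "s > 0"
        proof -
          have "(2 * (1 + s)) ^ k \<le> (4 * max 1 s) ^ k" using that by (intro power_mono) auto
          also have "\<dots> \<le> 4 ^ k * (1 + s ^ k)"
            using that unfolding power_mult_distrib by (intro mult_left_mono) (auto simp: max_def)
          finally show ?thesis .
        qed
        then have "(2 * (1 + s)) ^ k * exp (- s) \<le> 4 ^ k * (1 + s ^ k) * exp (- s)" if "s > 0"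
          using that by (intro mult_right_mono) auto
        then show "norm (W s) \<le> norm (4 ^ k * (indicator {0..} s * (s ^ 0 * exp (- s))
        + indicator {0..} s * (s ^ k * exp (- s))))"
          by (cases "s > 0") (auto simp: W_def abs_mult algebra_simps)
      qed
      show "W \<in> borel_measurable lborel" unfolding W_def by measurable
    qed
  qed
  define f where "f s = indicator {0<..} s * \<xi> s * exp (- s)" for s
  have f_meas [measurable]: "f \<in> borel_measurable borel"
    unfolding f_def by (rule borel_measurable_times[OF \<xi>_meas]) measurable
  define F where "F x s = indicator {0<..} s * (exp (- s) * h x s) / r x" for x s
  have F_meas [measurable]: "F x \<in> borel_measurable borel" for x unfolding F_def by measurable
  have lim_F: "((\<lambda>x. F x s) \<longlongrightarrow> f s) at_top" for s
  proof (cases "s > 0")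
    case True
    have "((\<lambda>x. exp (- s) * (h x s / r x)) \<longlongrightarrow> exp (- s) * \<xi> s) at_top"
      unfolding h_def by (intro tendsto_mult tendsto_const lim True)
    then show ?thesis using True by (simp add: F_def f_def mult.commute)
  qed (simp add: F_def f_def)
  have F_le: "\<forall>\<^sub>F x in at_top. \<forall>s. norm (F x s) \<le> W s"
    using r_pos bound
  proof eventually_elim
    case (elim x)
    show ?case
    proof
      fix s
      show "norm (F x s) \<le> W s"
      proof (cases "s > 0")
        case True
        have "h x s / r x \<le> (2 * (1 + s)) ^ k" "h x s \<ge> 0"
          using elim True by (auto simp: h_def divide_simps)
        then have "exp (- s) * (h x s / r x) \<le> exp (- s) * (2 * (1 + s)) ^ k"
          by (intro mult_left_mono) auto
        then show ?thesis using True elim \<open>h x s \<ge> 0\<close> by (simp add: F_def W_def mult.commute)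
      qed (simp add: F_def W_def)
    qed
  qed
  have F_le': "\<forall>\<^sub>F x in at_top. AE s in lborel. norm (F x s) \<le> W s"
    using F_le by eventually_elim simp
  have lim_F': "AE s in lborel. ((\<lambda>x. F x s) \<longlongrightarrow> f s) at_top" using lim_F by simp
  have f_int: "integrable lborel f"
    by (rule integrable_dominated_convergence_at_top[OF _ _ W_int lim_F' F_le']) auto
  then show "set_integrable lborel {0<..} (\<lambda>s. \<xi> s * exp (- s))"
    by (simp add: set_integrable_def f_def[abs_def] mult.assoc)
  have F_lim: "((\<lambda>x. \<integral>s. F x s \<partial>lborel) \<longlongrightarrow> (\<integral>s. f s \<partial>lborel)) at_top"
    by (rule integral_dominated_convergence_at_top[OF _ _ W_int lim_F' F_le']) auto
  \<comment> \<open>The density \<open>Suc k / (1 + s) ^ (k + 2)\<close> times the growth bound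
    \<open>(2 * (1 + s)) ^ k\<close> is \<open>C / (1 + s)\<close> with the denominator squared,
    whose integral is \<open>C\<close>.\<close>
  define C where "C = 2 ^ k * real (Suc k)"
  have C: "C > 0" by (simp add: C_def)
  text \<open>The distribution function of \<open>T x\<close> on \<open>Q\<close> grows polynomially, so a power weight of one
    degree higher has expectation of order \<open>r x\<close>.\<close>
  have weight: "(\<integral>\<omega>. indicator {\<omega>. Q \<omega>} \<omega> * (1 / (1 + T x \<omega>) ^ Suc k) \<partial>M) \<le> C * r x"
    if *: "AE \<omega> in M. Q \<omega> \<longrightarrow> 0 \<le> T x \<omega>" "\<forall>s>0. h x s \<le> (2 * (1 + s)) ^ k * r x" "r x > 0" for x
  proof -
    define G where "G s = indicator {0<..} s * (1 / (1 + s) ^ 2)" for s :: real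
    have "(\<integral>\<^sup>+s. ennreal (G s) \<partial>lborel)
        = (\<integral>\<^sup>+s. ennreal (real (Suc 0) / (1 + s) ^ (0 + 2)) * indicator {0<..} s \<partial>lborel)"
      by (intro nn_integral_cong) (auto simp: G_def indicator_def power2_eq_square)
    then have G: "(\<integral>\<^sup>+s. ennreal (G s) \<partial>lborel) = 1"
      using nn_integral_power_tail[of 0 0] by simp
    have G_nonneg: "G s \<ge> 0" for s by (simp add: G_def)
    have [measurable]: "G \<in> borel_measurable borel" unfolding G_def by measurable
    have G_int: "integrable lborel G"
      by (rule integrableI_nonneg) (auto simp: G G_nonneg)
    have G1: "(\<integral>s. G s \<partial>lborel) = 1"
      using G G_nonneg by (subst integral_eq_nn_integral) auto
    have "(\<integral>\<omega>. indicator {\<omega>. Q \<omega>} \<omega> * (1 / (1 + T x \<omega>) ^ Suc k) \<partial>M) =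
      (\<integral>s. indicator {0<..} s * (real (Suc k) / (1 + s) ^ (k + 2) * h x s) \<partial>lborel)"
      unfolding h_def
      by (rule integral_tail_function[where \<phi> = "\<lambda>t. 1 / (1 + t) ^ Suc k"])
        (use * nn_integral_power_tail in auto)
    also have "\<dots> \<le> (\<integral>s. C * r x * G s \<partial>lborel)"
    proof (rule integral_mono_AE')
      show "integrable lborel (\<lambda>s. C * r x * G s)" using G_int by simp
      show "AE s in lborel. indicator {0<..} s * (real (Suc k) / (1 + s) ^ (k + 2) * h x s) \<le> C * r x * G s"
      proof (rule AE_I2)
        fix s :: real
        show "indicator {0<..} s * (real (Suc k) / (1 + s) ^ (k + 2) * h x s) \<le> C * r x * G s"
        proof (cases "s > 0")
          case True
          have "real (Suc k) / (1 + s) ^ (k + 2) * h x s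
              \<le> real (Suc k) / (1 + s) ^ (k + 2) * ((2 * (1 + s)) ^ k * r x)"
            using * True by (intro mult_left_mono) auto
          also have "\<dots> = C * r x * (1 / (1 + s) ^ 2)"
            unfolding power_mult_distrib power_add C_def using True by (simp del: of_nat_Suc)
          finally show ?thesis using True by (simp add: G_def)
        qed (simp add: G_def)
      qed
      show "AE s in lborel. 0 \<le> C * r x * G s"
        using C * G_nonneg by auto
    qed
    also have "\<dots> = C * r x" using G1 by simp
    finally show ?thesis .
  qed
  define D where "D x = (\<integral>\<omega>. indicator {\<omega>. Q \<omega>} \<omega> * (S (x + T x \<omega> * b x) / S x) \<partial>M) / r x" for x
  \<comment> \<open>Accuracy \<open>\<epsilon> / C\<close> in the weighted uniform limit, times the
    weight's expectation \<open>C * r x\<close>, divided by \<open>r x\<close>, leaves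
    \<open>\<epsilon>\<close>.\<close>
  have D_close: "\<forall>\<^sub>F x in at_top. \<bar>D x - (\<integral>s. F x s \<partial>lborel)\<bar> \<le> \<epsilon>" if "\<epsilon> > 0" for \<epsilon>
  proof -
    have "\<forall>\<^sub>F x in at_top. \<forall>t\<ge>0. \<bar>S (x + t * b x) / S x - exp (- t)\<bar> \<le> (\<epsilon> / C) / (1 + t) ^ Suc k"
      using that C by (intro tail_weighted_uniform_limit) simp
    then show ?thesis using T_nonneg r_pos bound eventually_gt_at_top[of 0]
    proof eventually_elim
      case (elim x)
      note bx = b_pos[OF elim(5)]
      define I where "I = (indicator {\<omega>. Q \<omega>} :: 'a \<Rightarrow> real)"
      have [measurable]: "I \<in> borel_measurable M" unfolding I_def indicator_def mem_Collect_eq by measurable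
      have I: "I \<omega> = (if Q \<omega> then 1 else 0)" for \<omega> by (simp add: I_def)
      have int1: "integrable M (\<lambda>\<omega>. I \<omega> * (S (x + T x \<omega> * b x) / S x))"
      proof (rule integrable_const_bound[where B = 1])
        show "AE \<omega> in M. norm (I \<omega> * (S (x + T x \<omega> * b x) / S x)) \<le> 1"
          using elim(2)
        proof eventually_elim
          case (elim \<omega>)
          have "S (x + T x \<omega> * b x) \<le> S x" if "T x \<omega> \<ge> 0"
            using bx that by (intro antimono) simp
          then show ?case using elim S_pos[of x] S_pos[of "x + T x \<omega> * b x"]
            by (auto simp: I)
        qed
      qed measurable
      have int2: "integrable M (\<lambda>\<omega>. I \<omega> * exp (- T x \<omega>))"
        by (rule integrable_const_bound[where B = 1]) (use elim(2) in \<open>auto simp: I\<close>)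
      have int3: "integrable M (\<lambda>\<omega>. I \<omega> * (1 / (1 + T x \<omega>) ^ Suc k))"
      proof (rule integrable_const_bound[where B = 1])
        show "AE \<omega> in M. norm (I \<omega> * (1 / (1 + T x \<omega>) ^ Suc k)) \<le> 1"
          using elim(2)
        proof eventually_elim
          case (elim \<omega>)
          then show ?case
            by (auto simp: I divide_le_eq_1 simp del: power_Suc intro!: one_le_power)
        qed
      qed measurable
      have "(\<integral>\<omega>. I \<omega> * exp (- T x \<omega>) \<partial>M) = (\<integral>s. indicator {0<..} s * (exp (- s) * h x s) \<partial>lborel)"
        unfolding h_def I_def
        by (rule integral_tail_function[where \<phi> = "\<lambda>t. exp (- t)"])
          (use elim nn_integral_exp_tail in auto)
      then have "(\<integral>s. F x s \<partial>lborel) = (\<integral>\<omega>. I \<omega> * exp (- T x \<omega>) \<partial>M) / r x"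
        by (simp add: F_def)
      then have D_diff: "\<bar>D x - (\<integral>s. F x s \<partial>lborel)\<bar>
          = \<bar>\<integral>\<omega>. I \<omega> * (S (x + T x \<omega> * b x) / S x) - I \<omega> * exp (- T x \<omega>) \<partial>M\<bar> / r x"
        unfolding Bochner_Integration.integral_diff[OF int1 int2]
        using elim(3) by (simp only: D_def I_def diff_divide_distrib[symmetric] abs_divide abs_of_pos)
      have "\<bar>\<integral>\<omega>. I \<omega> * (S (x + T x \<omega> * b x) / S x) - I \<omega> * exp (- T x \<omega>) \<partial>M\<bar>
          \<le> (\<integral>\<omega>. \<bar>I \<omega> * (S (x + T x \<omega> * b x) / S x) - I \<omega> * exp (- T x \<omega>)\<bar> \<partial>M)"
        by (rule integral_abs_bound)
      also have "\<dots> \<le> (\<integral>\<omega>. \<epsilon> / C * (I \<omega> * (1 / (1 + T x \<omega>) ^ Suc k)) \<partial>M)"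
      proof (rule integral_mono_AE)
        show "AE \<omega> in M. \<bar>I \<omega> * (S (x + T x \<omega> * b x) / S x) - I \<omega> * exp (- T x \<omega>)\<bar>
            \<le> \<epsilon> / C * (I \<omega> * (1 / (1 + T x \<omega>) ^ Suc k))"
          using elim(2)
        proof eventually_elim
          case E: (elim \<omega>)
          show ?case
          proof (cases "Q \<omega>")
            case True
            then show ?thesis using E elim(1)[rule_format, of "T x \<omega>"] by (simp add: I del: power_Suc)
          qed (simp add: I)
        qed
        show "integrable M (\<lambda>\<omega>. \<epsilon> / C * (I \<omega> * (1 / (1 + T x \<omega>) ^ Suc k)))"
          using int3 by (rule integrable_mult_right)
      qed (use int1 int2 in auto)
      also have "\<dots> = \<epsilon> / C * (\<integral>\<omega>. I \<omega> * (1 / (1 + T x \<omega>) ^ Suc k) \<partial>M)"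
        by (rule integral_mult_right_zero)
      also have "\<dots> \<le> \<epsilon> / C * (C * r x)"
      proof (rule mult_left_mono)
        show "(\<integral>\<omega>. I \<omega> * (1 / (1 + T x \<omega>) ^ Suc k) \<partial>M) \<le> C * r x"
          unfolding I_def by (rule weight) (use elim in \<open>simp_all add: h_def\<close>)
      qed (use that C in simp)
      finally show ?case
        unfolding D_diff using elim(3) C by (simp add: divide_le_eq)
    qed
  qed
  have "((\<lambda>x. D x - (\<integral>s. F x s \<partial>lborel)) \<longlongrightarrow> 0) at_top"
  proof (rule tendstoI)
    fix e :: real assume "e > 0"
    then show "\<forall>\<^sub>F x in at_top. dist (D x - (\<integral>s. F x s \<partial>lborel)) 0 < e"
      using D_close[of "e / 2"] by (auto elim!: eventually_mono simp: dist_real_def)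
  qed
  from tendsto_add[OF this F_lim] have "(D \<longlongrightarrow> (\<integral>s. f s \<partial>lborel)) at_top" by simp
  then show "((\<lambda>x. (\<integral>\<omega>. indicator {\<omega>. Q \<omega>} \<omega> * (S (x + T x \<omega> * b x) / S x) \<partial>M) / r x)
      \<longlongrightarrow> (LBINT s:{0<..}. \<xi> s * exp (- s))) at_top"
    by (simp add: D_def[abs_def] f_def set_lebesgue_integral_def mult.assoc)
qed

end

text \<open>A vanishing integral would make \<open>f\<close> vanish almost everywhere, hence at
  almost every point of a unit interval beyond both \<open>c\<close> and \<open>d\<close>. The two
  bounds differ because \<open>\<xi>\<close> is positive only beyond
  \<open>max \<delta> \<eta>\<close>, while the integral starts at \<open>\<delta>\<close>.\<close>

lemma set_integral_pos_of_pos_tail: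
  fixes f :: "real \<Rightarrow> real"
  assumes int: "set_integrable lborel {c<..} f"
    and nonneg: "\<And>s. s > c \<Longrightarrow> f s \<ge> 0" and pos: "\<And>s. s > d \<Longrightarrow> f s > 0"
  shows "(LBINT s:{c<..}. f s) > 0"
proof -
  let ?f = "\<lambda>s. indicator {c<..} s *\<^sub>R f s"
  have int': "integrable lborel ?f" using int by (simp add: set_integrable_def)
  have nn: "AE s in lborel. 0 \<le> ?f s" using nonneg by (auto simp: indicator_def)
  define m where "m = max c d"
  have "integral\<^sup>L lborel ?f \<noteq> 0"
  proof
    assume "integral\<^sup>L lborel ?f = 0"
    then have "AE s in lborel. ?f s = 0"
      using integral_nonneg_eq_0_iff_AE[OF int' nn] by simp
    then have "AE s in lborel. s \<notin> {m<..<m + 1}"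
      by eventually_elim (use pos in \<open>force simp: indicator_def m_def\<close>)
    then have "{m<..<m + 1} \<in> null_sets lborel"
      by (subst AE_iff_null_sets) auto
    then have "emeasure lborel {m<..<m + 1} = 0" by (rule null_setsD1)
    then show False by simp
  qed
  moreover have "integral\<^sup>L lborel ?f \<ge> 0" using nn by (rule integral_nonneg_AE)
  ultimately show ?thesis by (simp add: set_lebesgue_integral_def)
qed

section \<open>Tails of products with an independent factor\<close>

text \<open>The library notion \<open>indep_var\<close> requires both variables to have the same type.\<close>

lemma (in prob_space) distr_Pair_of_indep_set:
  assumes [measurable]: "X \<in> measurable M N1" "Y \<in> measurable M N2"
    and indep: "indep_set (sets (vimage_algebra (space M) X N1)) (sets (vimage_algebra (space M) Y N2))"
  shows "distr M N1 X \<Otimes>\<^sub>M distr M N2 Y = distr M (N1 \<Otimes>\<^sub>M N2) (\<lambda>\<omega>. (X \<omega>, Y \<omega>))"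
proof (rule pair_measure_eqI)
  interpret X: prob_space "distr M N1 X" by (rule prob_space_distr) measurable
  interpret Y: prob_space "distr M N2 Y" by (rule prob_space_distr) measurable
  show "sigma_finite_measure (distr M N1 X)" "sigma_finite_measure (distr M N2 Y)" by unfold_locales
  fix A B assume A: "A \<in> sets (distr M N1 X)" and B: "B \<in> sets (distr M N2 Y)"
  then have AB: "A \<times> B \<in> sets (N1 \<Otimes>\<^sub>M N2)" by simp
  have "X -` A \<inter> space M \<in> sets (vimage_algebra (space M) X N1)"
    "Y -` B \<inter> space M \<in> sets (vimage_algebra (space M) Y N2)"
    using A B by (auto intro: in_vimage_algebra)
  then have "prob ((X -` A \<inter> space M) \<inter> (Y -` B \<inter> space M))
      = prob (X -` A \<inter> space M) * prob (Y -` B \<inter> space M)"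
    by (rule indep_setD[OF indep])
  moreover have "(\<lambda>\<omega>. (X \<omega>, Y \<omega>)) -` (A \<times> B) \<inter> space M
      = (X -` A \<inter> space M) \<inter> (Y -` B \<inter> space M)" by auto
  ultimately show "emeasure (distr M N1 X) A * emeasure (distr M N2 Y) B
      = emeasure (distr M (N1 \<Otimes>\<^sub>M N2) (\<lambda>\<omega>. (X \<omega>, Y \<omega>))) (A \<times> B)"
    using A B AB by (simp add: emeasure_distr emeasure_eq_measure ennreal_mult)
qed (simp cong: sets_pair_measure_cong)

text \<open>For \<open>R > 0\<close> and \<open>c > 0\<close>, \<open>R * u > c\<close> means that
  \<open>u > 0\<close> and \<open>R\<close> exceeds \<open>c / u\<close>. Given
  \<open>(U1, U2)\<close>, the event thus asks \<open>R\<close> to exceed the larger level, and by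
  independence this has the conditional probability \<open>1 - cdf\<close>.\<close>

lemma (in prob_space) prob_scaled_pair_greater:
  fixes R U1 U2 :: "'a \<Rightarrow> real" and c1 c2 :: real
  assumes [measurable]: "R \<in> borel_measurable M" "U1 \<in> borel_measurable M" "U2 \<in> borel_measurable M"
    and indep: "indep_set (sets (vimage_algebra (space M) R borel))
      (sets (vimage_algebra (space M) (\<lambda>\<omega>. (U1 \<omega>, U2 \<omega>)) borel))"
    and R_pos: "AE \<omega> in M. R \<omega> > 0" and c: "c1 > 0" "c2 > 0"
  shows "\<P>(\<omega> in M. R \<omega> * U1 \<omega> > c1 \<and> R \<omega> * U2 \<omega> > c2) =
    (\<integral>\<omega>. indicator {\<omega>. U1 \<omega> > 0 \<and> U2 \<omega> > 0} \<omega>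
      * (1 - cdf (distr M borel R) (max (c1 / U1 \<omega>) (c2 / U2 \<omega>))) \<partial>M)"
proof -
  define V where "V = (\<lambda>\<omega>. (U1 \<omega>, U2 \<omega>))"
  have [measurable]: "V \<in> measurable M (borel \<Otimes>\<^sub>M borel)" unfolding V_def by measurable
  define N where "N = distr M borel R"
  define P where "P = distr M (borel \<Otimes>\<^sub>M borel) V"
  interpret N: real_distribution N unfolding N_def by (rule real_distribution_distr) measurable
  interpret P: prob_space P unfolding P_def by (rule prob_space_distr) measurable
  interpret NP: pair_sigma_finite N P ..
  have joint: "N \<Otimes>\<^sub>M P = distr M (borel \<Otimes>\<^sub>M (borel \<Otimes>\<^sub>M borel)) (\<lambda>\<omega>. (R \<omega>, V \<omega>))"
    unfolding N_def P_def
    by (rule distr_Pair_of_indep_set) (measurable, use indep in \<open>simp add: V_def borel_prod\<close>)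
  \<comment> \<open>The positivity guards are essential: for \<open>u \<le> 0\<close> the quotient
    \<open>c / u\<close> is at most 0 (with \<open>c / 0 = 0\<close>), a level that \<open>R\<close>
    would exceed although \<open>R * u > c\<close> fails.\<close>
  define B where "B = {p :: real \<times> real \<times> real. fst (snd p) > 0 \<and> snd (snd p) > 0 \<and>
    max (c1 / fst (snd p)) (c2 / snd (snd p)) < fst p}"
  have B: "B \<in> sets (borel \<Otimes>\<^sub>M (borel \<Otimes>\<^sub>M borel))"
  proof -
    have "{p \<in> space (borel \<Otimes>\<^sub>M (borel \<Otimes>\<^sub>M borel)). fst (snd p) > 0 \<and> snd (snd p) > 0 \<and>
      max (c1 / fst (snd p)) (c2 / snd (snd p)) < fst p} \<in> sets (borel \<Otimes>\<^sub>M (borel \<Otimes>\<^sub>M borel))"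
      by measurable
    then show ?thesis by (simp add: B_def space_pair_measure)
  qed
  have [measurable]: "cdf N \<in> borel_measurable borel"
    by (rule borel_measurable_mono) (simp add: mono_def N.cdf_nondecreasing)
  define Z where "Z \<omega> = max (c1 / U1 \<omega>) (c2 / U2 \<omega>)" for \<omega>
  have tail: "measure N {z<..} = 1 - cdf N z" for z
  proof -
    have "measure N (UNIV - {..z}) = measure N UNIV - measure N {..z}"
      using N.finite_measure_compl[of "{..z}"] by simp
    moreover have "UNIV - {..z} = {z<..}" by auto
    ultimately show ?thesis using N.prob_space by (simp add: cdf_def)
  qed
  have "\<P>(\<omega> in M. R \<omega> * U1 \<omega> > c1 \<and> R \<omega> * U2 \<omega> > c2)
      = prob ((\<lambda>\<omega>. (R \<omega>, V \<omega>)) -` B \<inter> space M)"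
  proof (rule finite_measure_eq_AE)
    show "AE \<omega> in M. (\<omega> \<in> {\<omega> \<in> space M. R \<omega> * U1 \<omega> > c1 \<and> R \<omega> * U2 \<omega> > c2})
        = (\<omega> \<in> (\<lambda>\<omega>. (R \<omega>, V \<omega>)) -` B \<inter> space M)"
      using R_pos
    proof eventually_elim
      case (elim \<omega>)
      have "c < R \<omega> * u \<longleftrightarrow> u > 0 \<and> c / u < R \<omega>" if "c > 0" for c u
      proof (cases "u > 0")
        case False
        then have "R \<omega> * u \<le> 0" using elim by (simp add: mult_le_0_iff)
        then show ?thesis using False that by linarith
      qed (simp add: divide_less_eq)
      then show ?case using c by (auto simp: B_def V_def)
    qed
    show "(\<lambda>\<omega>. (R \<omega>, V \<omega>)) -` B \<inter> space M \<in> events"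
      by (rule measurable_sets[OF _ B]) measurable
  qed measurable
  also have "\<dots> = measure (N \<Otimes>\<^sub>M P) B"
    unfolding joint by (rule measure_distr[symmetric]) (use B in auto)
  also have "\<dots> = enn2real (\<integral>\<^sup>+y. emeasure N ((\<lambda>r. (r, y)) -` B) \<partial>P)"
    unfolding measure_def by (subst NP.emeasure_pair_measure_alt2) (use B in \<open>simp_all add: N_def P_def cong: sets_pair_measure_cong\<close>)
  also have "(\<integral>\<^sup>+y. emeasure N ((\<lambda>r. (r, y)) -` B) \<partial>P)
      = (\<integral>\<^sup>+y. indicator {y. fst y > 0 \<and> snd y > 0} y * ennreal (1 - cdf N (max (c1 / fst y) (c2 / snd y))) \<partial>P)"
  proof (rule nn_integral_cong)
    fix y :: "real \<times> real"
    have "(\<lambda>r. (r, y)) -` B = (if fst y > 0 \<and> snd y > 0 then {max (c1 / fst y) (c2 / snd y)<..} else {})"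
      by (auto simp: B_def)
    then show "emeasure N ((\<lambda>r. (r, y)) -` B) = indicator {y. fst y > 0 \<and> snd y > 0} y
        * ennreal (1 - cdf N (max (c1 / fst y) (c2 / snd y)))"
      by (simp add: N.emeasure_eq_measure tail)
  qed
  also have "\<dots> = (\<integral>\<^sup>+\<omega>. ennreal (indicator {\<omega>. U1 \<omega> > 0 \<and> U2 \<omega> > 0} \<omega> * (1 - cdf N (Z \<omega>))) \<partial>M)"
    unfolding P_def
    by (subst nn_integral_distr)
      (auto intro!: nn_integral_cong simp: indicator_def V_def Z_def, measurable)
  also have "enn2real \<dots> = (\<integral>\<omega>. indicator {\<omega>. U1 \<omega> > 0 \<and> U2 \<omega> > 0} \<omega> * (1 - cdf N (Z \<omega>)) \<partial>M)"
  proof (rule integral_eq_nn_integral[symmetric])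
    show "(\<lambda>\<omega>. indicator {\<omega>. U1 \<omega> > 0 \<and> U2 \<omega> > 0} \<omega> * (1 - cdf N (Z \<omega>))) \<in> borel_measurable M"
      unfolding indicator_def mem_Collect_eq Z_def by measurable
  qed (auto simp: indicator_def N.cdf_bounded_prob)
  finally show ?thesis by (simp add: Z_def N_def)
qed

section \<open>The joint tail\<close>

theorem proposition1:
  fixes M :: "'a measure"
    and R U1 U2 X Y Ua :: "'a \<Rightarrow> real"
    and F w v L :: "real \<Rightarrow> real"
    and \<xi> :: "real \<Rightarrow> real \<Rightarrow> real \<Rightarrow> real"
    and J :: "real \<Rightarrow> real \<Rightarrow> real"
    and a \<gamma> :: real
  assumes "prob_space M"
    and "R \<in> borel_measurable M" "U1 \<in> borel_measurable M" "U2 \<in> borel_measurable M"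
    and "prob_space.indep_set M (sets (vimage_algebra (space M) R borel))
          (sets (vimage_algebra (space M) (\<lambda>\<omega>. (U1 \<omega>, U2 \<omega>)) borel))"
    and "AE \<omega> in M. R \<omega> > 0"
    and X: "\<And>\<omega>. X \<omega> = R \<omega> * U1 \<omega>"
    and Y: "\<And>\<omega>. Y \<omega> = R \<omega> * U2 \<omega>"
    and F: "F = cdf (distr M borel R)"
    and "upper_endpoint F = \<infinity>"
    and w_pos: "\<And>x. x > 0 \<Longrightarrow> w x > 0"
    and "GMDA w F"
    and v: "\<And>x. v x = x * w x"
    and "AE \<omega> in M. 0 < U1 \<omega> \<and> U1 \<omega> \<le> 1"
    and "upper_endpoint (cdf (distr M borel U1)) = 1"
    and a: "0 < a" "a \<le> 1"
    and Ua: "\<And>\<omega>. Ua \<omega> = min (U1 \<omega>) (U2 \<omega> / a)"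
    and \<xi>_lim: "\<And>\<delta> \<eta> s. \<delta> \<ge> 0 \<Longrightarrow> \<eta> \<ge> 0 \<Longrightarrow> s > 0 \<Longrightarrow>
      ((\<lambda>x. \<P>(\<omega> in M. U1 \<omega> > 1 - (s - \<delta>) / x \<and> U2 \<omega> > a * (1 - (s - \<eta>) / x))
            / \<P>(\<omega> in M. Ua \<omega> > 1 - 1 / x)) \<longlongrightarrow> \<xi> s \<delta> \<eta>) at_top"
    and \<xi>_meas: "(\<lambda>(s, \<delta>, \<eta>). \<xi> s \<delta> \<eta>)
      \<in> borel_measurable (restrict_space borel ({0<..} \<times> {0..} \<times> {0..}))"
    and \<xi>_pos: "\<And>\<delta> \<eta> s. \<delta> \<ge> 0 \<Longrightarrow> \<eta> \<ge> 0 \<Longrightarrow> s > max \<delta> \<eta> \<Longrightarrow> \<xi> s \<delta> \<eta> > 0"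
    and \<gamma>: "\<gamma> \<ge> 0"
    and L_pos: "\<And>s. s > 0 \<Longrightarrow> L s > 0"
    and L_meas: "L \<in> borel_measurable (restrict_space borel {0<..})"
    and "slowly_varying_at_0 L"
    and Ua_tail: "\<And>s. s > 0 \<Longrightarrow> \<P>(\<omega> in M. Ua \<omega> > 1 - s) = s powr \<gamma> * L s"
    and J: "\<And>\<delta> \<eta>. J \<delta> \<eta> = (LBINT s:{\<delta><..}. \<xi> s \<delta> \<eta> * exp (- s))"
  shows "\<forall>\<delta>\<ge>0. \<forall>\<eta>\<ge>0.
    set_integrable lborel {\<delta><..} (\<lambda>s. \<xi> s \<delta> \<eta> * exp (- s)) \<and>
    J \<delta> \<eta> > 0 \<and>
    ((\<lambda>x. \<P>(\<omega> in M. X \<omega> > x * (1 + \<delta> / v x) \<and> Y \<omega> > a * x * (1 + \<eta> / v x))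
          / (J \<delta> \<eta> * L (1 / v x) * ((1 - F x) / v x powr \<gamma>))) \<longlongrightarrow> 1) at_top"
proof -
  interpret prob_space M by fact
  note [measurable] = assms(2-4)
  note R_pos = assms(6) and U1_AE = assms(14)
  interpret N: real_distribution "distr M borel R" by (rule real_distribution_distr) measurable
  have [measurable]: "Ua \<in> borel_measurable M" unfolding Ua[abs_def] by measurable

  \<comment> \<open>The survival function of \<open>R\<close> as a Gumbel tail\<close>
  define S where "S x = 1 - F x" for x
  define b where "b x = 1 / w x" for x
  have F_mono: "mono F" unfolding F by (simp add: mono_def N.cdf_nondecreasing)
  have S_lim: "(S \<longlongrightarrow> 0) at_top"
    using tendsto_diff[OF tendsto_const N.cdf_lim_at_top_prob, of 1] by (simp add: S_def[abs_def] F)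
  have S_nonpos: "S x = 1" if "x \<le> 0" for x
  proof -
    have "prob (R -` {..x} \<inter> space M) = 0"
      using R_pos that by (subst prob_eq_0) auto
    then show ?thesis by (simp add: S_def F cdf_def measure_distr)
  qed
  interpret gumbel_tail S b
  proof
    show "S y \<le> S x" if "x \<le> y" for x y using monoD[OF F_mono that] by (simp add: S_def)
    show "S x > 0" for x
      using less_one_of_upper_endpoint_infinity[OF assms(10) F_mono] by (simp add: S_def)
    show "((\<lambda>x. S (x + t * b x) / S x) \<longlongrightarrow> exp (- t)) at_top" for t
      using assms(12) by (simp add: GMDA_def S_def b_def)
  qed (simp add: b_def w_pos)
  \<comment> \<open>Here \<open>x / b x\<close> is \<open>v x\<close>.\<close>
  have v_lim: "filterlim v at_top at_top"
    using filterlim_ratio_scale[OF S_lim S_nonpos] by (simp add: b_def v[abs_def])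
  have v_pos: "v x > 0" if "x > 0" for x using that w_pos by (simp add: v)

  \<comment> \<open>Regular variation of the tail of \<open>Ua\<close>\<close>
  define p where "p s = \<P>(\<omega> in M. Ua \<omega> > 1 - s)" for s
  have p_mono: "p s \<le> p t" if "s \<le> t" for s t
    unfolding p_def using that by (intro finite_measure_mono) auto
  have p_eq: "p s = s powr \<gamma> * L s" if "s > 0" for s
    using Ua_tail[OF that] by (simp add: p_def)
  have p_pos: "p s > 0" if "s > 0" for s using that L_pos by (simp add: p_eq)
  have p_le_1: "p s \<le> 1" for s unfolding p_def by simp
  have p_lim: "((\<lambda>u. p (t * u) / p u) \<longlongrightarrow> t powr \<gamma>) (at_right 0)" if "t > 0" for t
  proof -
    \<comment> \<open>Slow variation is stated for the reciprocal of the quotient that occurs in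
      \<open>p (t * u) / p u\<close>, hence the \<open>inverse\<close>.\<close>
    have "((\<lambda>u. L u / L (t * u)) \<longlongrightarrow> 1) (at_right 0)"
      using \<open>slowly_varying_at_0 L\<close> that by (simp add: slowly_varying_at_0_def)
    then have "((\<lambda>u. t powr \<gamma> * inverse (L u / L (t * u))) \<longlongrightarrow> t powr \<gamma> * inverse 1) (at_right 0)"
      by (intro tendsto_intros) auto
    moreover have "\<forall>\<^sub>F u in at_right 0. t powr \<gamma> * inverse (L u / L (t * u)) = p (t * u) / p u"
      using eventually_at_right_less[of 0]
      by eventually_elim (use that in \<open>simp add: p_eq powr_mult\<close>)
    ultimately have "((\<lambda>u. p (t * u) / p u) \<longlongrightarrow> t powr \<gamma> * inverse 1) (at_right 0)"
      by (rule Lim_transform_eventually)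
    then show ?thesis by simp
  qed
  obtain k where k: "\<And>s u. s > 0 \<Longrightarrow> u > 0 \<Longrightarrow> p (s * u) \<le> (2 * (1 + s)) ^ k * p u"
    using bounded_regularly_varying_power_bound[of p] p_mono p_pos p_le_1 p_lim[of 2] by force

  show ?thesis
  proof (intro allI impI)
    fix \<delta> \<eta> :: real assume \<delta>: "0 \<le> \<delta>" and \<eta>: "0 \<le> \<eta>"

    \<comment> \<open>The law of the rescaled level \<open>T\<close>\<close>
    define G where "G s z = \<P>(\<omega> in M. U1 \<omega> > 1 - (s - \<delta>) / z \<and> U2 \<omega> > a * (1 - (s - \<eta>) / z))" for s z
    define Q where "Q \<omega> \<longleftrightarrow> U1 \<omega> > 0 \<and> U2 \<omega> > 0" for \<omega>
    define c1 where "c1 x = x * (1 + \<delta> / v x)" for x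
    define c2 where "c2 x = a * x * (1 + \<eta> / v x)" for x
    text \<open>On \<open>Q\<close>, \<open>x + T x \<omega> * b x\<close> is the level that \<open>R\<close> has to exceed.\<close>
    define T where "T x \<omega> = w x * (max (c1 x / U1 \<omega>) (c2 x / U2 \<omega>) - x)" for x \<omega>
    define r where "r x = p (1 / v x)" for x
    have Q_meas: "Measurable.pred M Q" unfolding Q_def by measurable
    have T_meas: "T x \<in> borel_measurable M" for x unfolding T_def by measurable
    have c_pos: "c1 x > 0" "c2 x > 0" if "x > 0" for x
      using that v_pos[OF that] \<delta> \<eta> a by (auto simp: c1_def c2_def intro!: mult_pos_pos add_pos_nonneg)
    \<comment> \<open>In units of \<open>b x\<close> the level of \<open>R\<close> for
      \<open>U1\<close> is \<open>(v x + \<delta>) / U1\<close>, so \<open>T < s\<close> asks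
      \<open>U1\<close> to exceed \<open>(v x + \<delta>) / (v x + s)\<close>, and similarly for
      \<open>U2\<close>. This is the event of the hypothesis on \<open>\<xi>\<close> at
      \<open>v x + s\<close>, not at \<open>v x\<close>.\<close>
    have event: "\<P>(\<omega> in M. Q \<omega> \<and> T x \<omega> < s) = G s (v x + s)" if x: "x > 0" and s: "s > 0" for x s
    proof -
      have vx: "v x > 0" "w x > 0" "v x + s > 0" using v_pos[OF x] w_pos[OF x] s by auto
      have level: "u > 0 \<and> w x * (c * (x * (1 + d / v x)) / u - x) < s \<longleftrightarrow> u > c * (1 - (s - d) / (v x + s))"
        if "c > 0" "d \<ge> 0" for c d u
      proof -
        have 1: "1 - (s - d) / (v x + s) = (v x + d) / (v x + s)" using vx by (simp add: field_simps)
        have "w x * (x * (1 + d / v x)) = v x + d"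
          using vx x by (simp add: v field_simps)
        then have 2: "w x * (c * (x * (1 + d / v x)) / u - x) = c * (v x + d) / u - v x"
          by (simp only: v right_diff_distrib times_divide_eq_right mult_ac)
        \<comment> \<open>A positive threshold makes the guard \<open>u > 0\<close> automatic in the
          right-hand event.\<close>
        have "c * (v x + d) / (v x + s) > 0" using that vx by (intro divide_pos_pos mult_pos_pos) auto
        then have "u > 0" if "u > c * ((v x + d) / (v x + s))" using that by simp
        moreover have "c * (v x + d) / u - v x < s \<longleftrightarrow> u > c * ((v x + d) / (v x + s))" if "u > 0"
          using that vx by (simp add: field_simps)
        ultimately show ?thesis unfolding 1 2 by blast
      qed
      have "w x * (z - x) < s \<longleftrightarrow> z < s / w x + x" for z using vx by (simp add: field_simps)
      then have split_max: "w x * (max A B - x) < s \<longleftrightarrow> w x * (A - x) < s \<and> w x * (B - x) < s" for A B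
        by simp
      have "Q \<omega> \<and> T x \<omega> < s \<longleftrightarrow> U1 \<omega> > 1 - (s - \<delta>) / (v x + s) \<and> U2 \<omega> > a * (1 - (s - \<eta>) / (v x + s))" for \<omega>
        using level[of 1 \<delta> "U1 \<omega>"] level[of a \<eta> "U2 \<omega>"] \<delta> \<eta> a vx
        by (auto simp: Q_def T_def c1_def c2_def split_max mult.assoc)
      then show ?thesis by (simp add: G_def)
    qed
    have T_nonneg: "\<forall>\<^sub>F x in at_top. AE \<omega> in M. Q \<omega> \<longrightarrow> 0 \<le> T x \<omega>"
      using eventually_gt_at_top[of 0]
    proof eventually_elim
      case (elim x)
      show ?case using U1_AE
      proof eventually_elim
        case (elim \<omega>)
        \<comment> \<open>The first component alone keeps the maximum above \<open>x\<close>,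
          because \<open>U1 \<le> 1\<close>.\<close>
        have "x \<le> c1 x" using \<open>x > 0\<close> v_pos[OF \<open>x > 0\<close>] \<delta> by (simp add: c1_def)
        also have "c1 x \<le> c1 x / U1 \<omega>"
          using elim c_pos[OF \<open>x > 0\<close>] by (simp add: le_divide_eq mult_left_le)
        finally show ?case using w_pos[OF \<open>x > 0\<close>] by (simp add: T_def)
      qed
    qed
    have r_pos: "\<forall>\<^sub>F x in at_top. r x > 0"
      using eventually_gt_at_top[of 0] by eventually_elim (simp add: r_def p_pos v_pos)
    have bound: "\<forall>\<^sub>F x in at_top. \<forall>s>0. \<P>(\<omega> in M. Q \<omega> \<and> T x \<omega> < s) \<le> (2 * (1 + s)) ^ k * r x"
      using eventually_gt_at_top[of 0]
    proof (eventually_elim, intro allI impI)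
      fix x s :: real assume x: "0 < x" and s: "0 < s"
      note vx = v_pos[OF x]
      \<comment> \<open>Dropping the nonnegative \<open>\<delta>\<close> and \<open>\<eta>\<close>
        lowers both thresholds, and the two conditions merge into one on \<open>Ua\<close>.\<close>
      have "G s (v x + s) \<le> p (s / (v x + s))"
        unfolding G_def p_def
      proof (rule finite_measure_mono)
        have le: "1 - s / (v x + s) \<le> 1 - (s - d) / (v x + s)" if "d \<ge> 0" for d
          using that vx s by (simp add: divide_right_mono)
        have "a * (1 - s / (v x + s)) < U2 \<omega>" if "a * (1 - (s - \<eta>) / (v x + s)) < U2 \<omega>" for \<omega>
          using that mult_left_mono[OF le[OF \<eta>], of a] a by linarith
        then show "{\<omega> \<in> space M. U1 \<omega> > 1 - (s - \<delta>) / (v x + s) \<and> U2 \<omega> > a * (1 - (s - \<eta>) / (v x + s))}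
            \<subseteq> {\<omega> \<in> space M. Ua \<omega> > 1 - s / (v x + s)}"
          using le[OF \<delta>] a by (auto simp: Ua less_divide_eq mult.commute)
      qed measurable
      also have "\<dots> \<le> p (s * (1 / v x))" using vx s by (intro p_mono) (simp add: frac_le)
      also have "\<dots> \<le> (2 * (1 + s)) ^ k * r x" unfolding r_def using vx s by (intro k) auto
      finally show "\<P>(\<omega> in M. Q \<omega> \<and> T x \<omega> < s) \<le> (2 * (1 + s)) ^ k * r x"
        unfolding event[OF x s] .
    qed
    have lim: "((\<lambda>x. \<P>(\<omega> in M. Q \<omega> \<and> T x \<omega> < s) / r x) \<longlongrightarrow> \<xi> s \<delta> \<eta>) at_top" if s: "s > 0" for s
    proof -
      \<comment> \<open>The hypothesis normalises by \<open>p (1 / (v x + s))\<close>; changing this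
        to \<open>p (1 / v x)\<close> costs a factor that tends to 1.\<close>
      have "filterlim (\<lambda>x. v x + s) at_top at_top"
        by (rule filterlim_at_top_mono[OF v_lim]) (use s in simp)
      then have "((\<lambda>x. G s (v x + s) / p (1 / (v x + s))) \<longlongrightarrow> \<xi> s \<delta> \<eta>) at_top"
        using filterlim_compose[OF \<xi>_lim[OF \<delta> \<eta> s]] by (simp add: G_def p_def)
      moreover have "((\<lambda>x. p (1 / (v x + s)) / p (1 / v x)) \<longlongrightarrow> 1) at_top"
        by (rule filterlim_compose[OF regularly_varying_shift[OF _ p_pos p_lim s] v_lim]) (rule p_mono)
      ultimately have "((\<lambda>x. G s (v x + s) / p (1 / (v x + s)) * (p (1 / (v x + s)) / p (1 / v x)))
          \<longlongrightarrow> \<xi> s \<delta> \<eta> * 1) at_top"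
        by (rule tendsto_mult)
      moreover have "\<forall>\<^sub>F x in at_top. G s (v x + s) / p (1 / (v x + s)) * (p (1 / (v x + s)) / p (1 / v x))
          = \<P>(\<omega> in M. Q \<omega> \<and> T x \<omega> < s) / r x"
        using eventually_gt_at_top[of 0]
      proof eventually_elim
        case (elim x)
        have "p (1 / (v x + s)) > 0" using v_pos[OF elim] s by (intro p_pos) simp
        then show ?case using event[OF elim s] by (simp add: r_def)
      qed
      ultimately have "((\<lambda>x. \<P>(\<omega> in M. Q \<omega> \<and> T x \<omega> < s) / r x) \<longlongrightarrow> \<xi> s \<delta> \<eta> * 1) at_top"
        by (rule Lim_transform_eventually)
      then show ?thesis by simp
    qed
    \<comment> \<open>The section of \<open>\<xi>\<close> at fixed \<open>\<delta>\<close> and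
      \<open>\<eta>\<close>, after extending \<open>\<xi>\<close> by 0 outside the domain on which
      it is measurable.\<close>
    have \<xi>_meas': "(\<lambda>s. indicator {0<..} s * \<xi> s \<delta> \<eta>) \<in> borel_measurable borel"
    proof -
      let ?\<Omega> = "{0<..} \<times> {0..} \<times> {0..} :: (real \<times> real \<times> real) set"
      have "?\<Omega> \<in> sets borel" by (intro borel_Times) auto
      then have "(\<lambda>q. indicator ?\<Omega> q *\<^sub>R (\<lambda>(s, \<delta>, \<eta>). \<xi> s \<delta> \<eta>) q) \<in> borel_measurable borel"
        using \<xi>_meas by (subst (asm) borel_measurable_restrict_space_iff) auto
      moreover have "(\<lambda>s. (s, \<delta>, \<eta>)) \<in> borel_measurable borel"
        by (intro borel_measurable_continuous_onI continuous_intros)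
      ultimately have "(\<lambda>s. indicator ?\<Omega> (s, \<delta>, \<eta>) *\<^sub>R (\<lambda>(s, \<delta>, \<eta>). \<xi> s \<delta> \<eta>) (s, \<delta>, \<eta>)) \<in> borel_measurable borel"
        by (rule measurable_compose[rotated])
      then show ?thesis using \<delta> \<eta> by (simp add: indicator_def cong: if_cong)
    qed
    note main = expectation_limit[OF prob_space_axioms Q_meas T_meas T_nonneg r_pos bound lim \<xi>_meas']

    \<comment> \<open>Integrability and positivity of \<open>J\<close>\<close>
    have \<xi>_nonneg: "\<xi> s \<delta> \<eta> \<ge> 0" if "s > 0" for s
      using lim[OF that] r_pos
      by (intro tendsto_lowerbound[OF lim[OF that]]) (auto elim!: eventually_mono)
    \<comment> \<open>For \<open>s \<le> \<delta>\<close> the threshold for \<open>U1\<close> is at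
      least 1, which \<open>U1\<close> almost surely does not exceed. Hence integrating over
      \<open>{0<..}\<close> or over \<open>{\<delta><..}\<close> gives the same value.\<close>
    have \<xi>_zero: "\<xi> s \<delta> \<eta> = 0" if "s > 0" "s \<le> \<delta>" for s
    proof -
      have "\<forall>\<^sub>F x in at_top. \<P>(\<omega> in M. Q \<omega> \<and> T x \<omega> < s) / r x = 0"
        using eventually_gt_at_top[of 0]
      proof eventually_elim
        case (elim x)
        have "1 - (s - \<delta>) / (v x + s) \<ge> 1"
          using v_pos[OF elim] that by (simp add: divide_le_0_iff)
        then have "G s (v x + s) = 0"
          unfolding G_def using U1_AE by (subst prob_eq_0) auto
        then show ?case using event[OF elim that(1)] by simp
      qed
      then have "((\<lambda>x. \<P>(\<omega> in M. Q \<omega> \<and> T x \<omega> < s) / r x) \<longlongrightarrow> 0) at_top"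
        by (rule tendsto_eventually)
      then show ?thesis by (rule tendsto_unique[OF trivial_limit_at_top_linorder lim[OF that(1)]])
    qed
    have indicator_eq: "indicator {0<..} s *\<^sub>R (\<xi> s \<delta> \<eta> * exp (- s)) = indicator {\<delta><..} s *\<^sub>R (\<xi> s \<delta> \<eta> * exp (- s))" for s
      using \<delta> \<xi>_zero[of s] by (auto simp: indicator_def)
    have int: "set_integrable lborel {\<delta><..} (\<lambda>s. \<xi> s \<delta> \<eta> * exp (- s))"
      using main(1) unfolding set_integrable_def indicator_eq .
    have J_eq: "J \<delta> \<eta> = (LBINT s:{0<..}. \<xi> s \<delta> \<eta> * exp (- s))"
      unfolding J set_lebesgue_integral_def indicator_eq ..
    have J_pos: "J \<delta> \<eta> > 0"
      unfolding J using \<delta> \<eta> \<xi>_nonneg \<xi>_pos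
      by (intro set_integral_pos_of_pos_tail[OF int, where d = "max \<delta> \<eta>"]) auto

    \<comment> \<open>Identification of the limit with the claimed asymptotics\<close>
    have "((\<lambda>x. (\<integral>\<omega>. indicator {\<omega>. Q \<omega>} \<omega> * (S (x + T x \<omega> * b x) / S x) \<partial>M) / r x / J \<delta> \<eta>)
        \<longlongrightarrow> J \<delta> \<eta> / J \<delta> \<eta>) at_top"
      using main(2) J_pos unfolding J_eq by (intro tendsto_divide tendsto_const) auto
    moreover have "\<forall>\<^sub>F x in at_top.
        (\<integral>\<omega>. indicator {\<omega>. Q \<omega>} \<omega> * (S (x + T x \<omega> * b x) / S x) \<partial>M) / r x / J \<delta> \<eta> =
        \<P>(\<omega> in M. X \<omega> > x * (1 + \<delta> / v x) \<and> Y \<omega> > a * x * (1 + \<eta> / v x))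
          / (J \<delta> \<eta> * L (1 / v x) * ((1 - F x) / v x powr \<gamma>))"
      using eventually_gt_at_top[of 0]
    proof eventually_elim
      case (elim x)
      have level: "x + T x \<omega> * b x = max (c1 x / U1 \<omega>) (c2 x / U2 \<omega>)" for \<omega>
        using w_pos[OF elim] by (simp add: T_def b_def)
      have "\<P>(\<omega> in M. X \<omega> > c1 x \<and> Y \<omega> > c2 x)
          = (\<integral>\<omega>. indicator {\<omega>. Q \<omega>} \<omega> * S (x + T x \<omega> * b x) \<partial>M)"
        unfolding X Y level Q_def S_def F
        by (rule prob_scaled_pair_greater[OF assms(2-5) R_pos c_pos[OF elim]])
      then have ratio: "(\<integral>\<omega>. indicator {\<omega>. Q \<omega>} \<omega> * (S (x + T x \<omega> * b x) / S x) \<partial>M)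
          = \<P>(\<omega> in M. X \<omega> > c1 x \<and> Y \<omega> > c2 x) / S x"
        by simp
      have r_eq: "r x = L (1 / v x) / v x powr \<gamma>"
        using v_pos[OF elim] by (simp add: r_def p_eq powr_divide)
      show ?case unfolding ratio r_eq by (simp add: c1_def c2_def S_def mult_ac)
    qed
    ultimately have "((\<lambda>x. \<P>(\<omega> in M. X \<omega> > x * (1 + \<delta> / v x) \<and> Y \<omega> > a * x * (1 + \<eta> / v x))
          / (J \<delta> \<eta> * L (1 / v x) * ((1 - F x) / v x powr \<gamma>))) \<longlongrightarrow> J \<delta> \<eta> / J \<delta> \<eta>) at_top"
      by (rule Lim_transform_eventually)
    then show "set_integrable lborel {\<delta><..} (\<lambda>s. \<xi> s \<delta> \<eta> * exp (- s)) \<and> J \<delta> \<eta> > 0 \<and>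
      ((\<lambda>x. \<P>(\<omega> in M. X \<omega> > x * (1 + \<delta> / v x) \<and> Y \<omega> > a * x * (1 + \<eta> / v x))
          / (J \<delta> \<eta> * L (1 / v x) * ((1 - F x) / v x powr \<gamma>))) \<longlongrightarrow> 1) at_top"
      using int J_pos by simp
  qed
qed

end
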